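(* Suppose $\mathcal{G}$ is a canonical DAG over main variables $\bm{V}=\{V_1,\dots,V_J\}$ and disturbances $\bm{U}=\{U_1,\dots,U_K\}$, where the disturbances take values in finite sets $\mathcal{S}(U_1),\dots,\mathcal{S}(U_K)$. Let $\mathcal{C}=\{\mathcal{C}_\ell\}_\ell$, with $\mathcal{C}_\ell$ the statement $V_{\ell}(\bm{a}_\ell)=v_\ell$, be a set of counterfactual statements, indexed by $\ell$, that variable $V_\ell$ will take on value $v_\ell$ under manipulation $\bm{a}_\ell$. Let $\mathcal{U}\subseteq\mathcal{S}(\bm{U})=\prod_k\mathcal{S}(U_k)$ be the subset of disturbance realizations that lead deterministically to every statement in $\mathcal{C}$ being satisfied. Then under the structural equation model $\mathcal{G}$, $$\Pr\Big(\bigwedge_{\ell}\mathcal{C}_\ell\Big)=\sum_{\bm{u}\in\mathcal{U}}\ \prod_{u_k\in\bm{u}}\Pr(U_k=u_k),$$ which is a polynomial equation in $\mathcal{P}_{\bm{U}}=\{\Pr(U_k=u_k): k,\ u_k\in\mathcal{S}(U_k)\}$, the parameters of the distribution $\Pr(\bm{U}=\bm{u})$.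
   Context: $\mathcal{G}$ is a directed acyclic graph on $\bm{V}\cup\bm{U}$; $\bm{pa}(X)$ denotes the parents of $X$ in $\mathcal{G}$. Main variables take values in finite sets. $\mathcal{G}$ is canonical if (i) no disturbance has a parent in $\mathcal{G}$, and (ii) there is no pair of distinct disturbances $U,U'$ such that the set of children of $U$ is a subset of the set of children of $U'$. Under the structural equation model, the disturbances are mutually independent, and each main variable is a fixed deterministic function $V_j=f_j(\bm{pa}(V_j))$ of its parents, so disturbances are the only source of randomness. Potential outcomes: for $\bm{A}\subseteq\bm{V}$ and values $\bm{a}$ of $\bm{A}$, $V_j(\bm{a})$ is defined recursively as $f_j$ evaluated with each main parent of $V_j$ in $\bm{A}$ set to its value in $\bm{a}$, each main parent $V_{j'}\notin\bm{A}$ set to $V_{j'}(\bm{a})$, and disturbances at their realized values. Intervention on $V_j$ itself is ignored in $V_j(\bm{a})$; $V_j(\varnothing)=V_j$. Different statements in $\mathcal{C}$ may involve different interventions $\bm{a}_\ell$. *)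

theory Defs
  imports "HOL-Probability.Probability" "HOL-Library.Poly_Mapping"
begin

definition parents :: "('n \<times> 'n) set \<Rightarrow> 'n \<Rightarrow> 'n set" where
  "parents E x = {y. (y, x) \<in> E}"

definition children :: "('n \<times> 'n) set \<Rightarrow> 'n \<Rightarrow> 'n set" where
  "children E x = {y. (x, y) \<in> E}"

locale latent_dag =
  fixes V U :: "'n set" and E :: "('n \<times> 'n) set"
  assumes finite_V: "finite V"
    and finite_U: "finite U"
    and disjoint_VU: "V \<inter> U = {}"
    and edges: "E \<subseteq> (V \<union> U) \<times> (V \<union> U)"
    and acyclic: "acyclic E"

locale canonical_dag = latent_dag V U E
  for V U :: "'n set" and E :: "('n \<times> 'n) set" +
  assumes disturbance_no_parents: "\<And>k. k \<in> U \<Longrightarrow> parents E k = {}"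
    and children_not_nested:
      "\<And>k k'. k \<in> U \<Longrightarrow> k' \<in> U \<Longrightarrow> k \<noteq> k' \<Longrightarrow> \<not> children E k \<subseteq> children E k'"

text \<open>
  An intervention is a partial assignment \<open>a\<close>; \<open>u\<close> is a disturbance realization.
  The value \<open>a j\<close> plays no role in the outcome of \<open>j\<close> itself, only in that of its
  descendants.
\<close>

definition potential_outcome ::
    "'n set \<Rightarrow> ('n \<times> 'n) set \<Rightarrow> ('n \<Rightarrow> ('n \<Rightarrow> 'a) \<Rightarrow> 'a) \<Rightarrow> ('n \<rightharpoonup> 'a) \<Rightarrow> ('n \<Rightarrow> 'a) \<Rightarrow> 'n \<Rightarrow> 'a" where
  "potential_outcome U E f a u =
     wfrec E (\<lambda>g j. f j (\<lambda>i\<in>parents E j.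
       if i \<in> U then u i else case a i of Some x \<Rightarrow> x | None \<Rightarrow> g i))"

lemma (in latent_dag) wf_E: "wf E"
  using finite_V finite_U edges acyclic
  by (meson finite_SigmaI finite_UnI finite_acyclic_wf finite_subset)

lemma (in latent_dag) potential_outcome_rec:
  "potential_outcome U E f a u j = f j (\<lambda>i\<in>parents E j.
     if i \<in> U then u i
     else case a i of Some x \<Rightarrow> x | None \<Rightarrow> potential_outcome U E f a u i)"
  unfolding potential_outcome_def
  by (subst wfrec[OF wf_E])
    (auto intro!: arg_cong[where f = "f j"] simp: restrict_def fun_eq_iff parents_def cut_apply
      split: option.split)

text \<open>
  The structural equation model: \<open>X i\<close> is the random variable at node \<open>i\<close>, with values in
  \<open>S i\<close>; the argument of \<open>f j\<close> is an assignment of values to the parents of \<open>j\<close>.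
\<close>

locale structural_equation_model = latent_dag V U E + prob_space M
  for V U :: "'n set" and E :: "('n \<times> 'n) set" and M :: "'w measure" +
  fixes S :: "'n \<Rightarrow> 'a set"
    and f :: "'n \<Rightarrow> ('n \<Rightarrow> 'a) \<Rightarrow> 'a"
    and X :: "'n \<Rightarrow> 'w \<Rightarrow> 'a"
  assumes finite_S: "\<And>i. i \<in> V \<union> U \<Longrightarrow> finite (S i)"
    and f_type: "\<And>j. j \<in> V \<Longrightarrow> f j \<in> (\<Pi>\<^sub>E i\<in>parents E j. S i) \<rightarrow> S j"
    and disturbances_indep: "indep_vars (\<lambda>k. count_space (S k)) X U"
    and structural_equation:
      "\<And>j \<omega>. j \<in> V \<Longrightarrow> \<omega> \<in> space M \<Longrightarrow> X j \<omega> = f j (\<lambda>i\<in>parents E j. X i \<omega>)"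

lemma (in structural_equation_model) potential_outcome_no_intervention:
  assumes "\<omega> \<in> space M" and "j \<in> V"
  shows "potential_outcome U E f Map.empty (\<lambda>k. X k \<omega>) j = X j \<omega>"
  using assms(2)
proof (induction j rule: wf_induct_rule[OF wf_E])
  case (1 j)
  have "(if i \<in> U then X i \<omega> else potential_outcome U E f Map.empty (\<lambda>k. X k \<omega>) i) = X i \<omega>"
    if "i \<in> parents E j" for i
    using that 1 edges by (auto simp: parents_def)
  then have "(\<lambda>i\<in>parents E j. if i \<in> U then X i \<omega>
        else potential_outcome U E f Map.empty (\<lambda>k. X k \<omega>) i) = (\<lambda>i\<in>parents E j. X i \<omega>)"
    by (intro restrict_ext) auto
  then show ?case
    using structural_equation[OF 1(2) assms(1)] by (subst potential_outcome_rec) (simp only: option.case)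
qed

definition intervention :: "'n set \<Rightarrow> ('n \<Rightarrow> 'a set) \<Rightarrow> ('n \<rightharpoonup> 'a) \<Rightarrow> bool" where
  "intervention V S a \<longleftrightarrow> dom a \<subseteq> V \<and> (\<forall>j\<in>dom a. the (a j) \<in> S j)"

text \<open>
  The counterfactual statements are indexed by \<open>L\<close>: statement \<open>l\<close> says that variable \<open>c l\<close>
  takes the value \<open>v l\<close> under the intervention \<open>a l\<close>.
\<close>

definition satisfying_realizations ::
    "'n set \<Rightarrow> ('n \<times> 'n) set \<Rightarrow> ('n \<Rightarrow> 'a set) \<Rightarrow> ('n \<Rightarrow> ('n \<Rightarrow> 'a) \<Rightarrow> 'a) \<Rightarrow>
     'l set \<Rightarrow> ('l \<Rightarrow> 'n) \<Rightarrow> ('l \<Rightarrow> 'n \<rightharpoonup> 'a) \<Rightarrow> ('l \<Rightarrow> 'a) \<Rightarrow> ('n \<Rightarrow> 'a) set" where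
  "satisfying_realizations U E S f L c a v =
     {u \<in> (\<Pi>\<^sub>E k\<in>U. S k). \<forall>l\<in>L. potential_outcome U E f (a l) u (c l) = v l}"

text \<open>
  Multivariate polynomials with indeterminates in \<open>'x\<close>, as finitely supported maps from
  monomials (exponent vectors) to coefficients.
\<close>

type_synonym ('x, 'r) mpolynomial = "('x \<Rightarrow>\<^sub>0 nat) \<Rightarrow>\<^sub>0 'r"

definition indeterminates :: "('x, 'r::zero) mpolynomial \<Rightarrow> 'x set" where
  "indeterminates p = (\<Union>m\<in>Poly_Mapping.keys p. Poly_Mapping.keys m)"

definition eval_mpolynomial :: "('x \<Rightarrow> 'r) \<Rightarrow> ('x, 'r::comm_semiring_1) mpolynomial \<Rightarrow> 'r" where
  "eval_mpolynomial \<theta> p =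
     (\<Sum>m\<in>Poly_Mapping.keys p. Poly_Mapping.lookup p m *
        (\<Prod>x\<in>Poly_Mapping.keys m. \<theta> x ^ Poly_Mapping.lookup m x))"

end

theory Submission imports Defs begin

text \<open>
  A potential outcome depends only on the values of the disturbances, so the event in question is
  the disjoint union, over the satisfying realizations \<open>u\<close>, of the events \<open>\<forall>k\<in>U. X k \<omega> = u k\<close>, whose
  probabilities factor by independence. The monomials \<open>\<Prod>k\<in>U. \<theta> (k, u k)\<close> are squarefree and
  correspond to the graphs of the functions \<open>u\<close>, so they are pairwise distinct and the polynomial has
  all coefficients equal to one.
\<close>

text \<open>\<open>Abs_poly_mapping\<close> is meaningful only on functions of finite support, hence
  the finiteness hypotheses below. The value type stays polymorphic because both exponents and
  coefficients are built this way.\<close>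

definition indicator_mapping :: "'x set \<Rightarrow> 'x \<Rightarrow>\<^sub>0 'b::zero_neq_one" where
  "indicator_mapping A = Abs_poly_mapping (\<lambda>x. of_bool (x \<in> A))"

lemma lookup_indicator_mapping:
  assumes "finite A"
  shows "Poly_Mapping.lookup (indicator_mapping A) x = of_bool (x \<in> A)"
  using assms by (simp add: indicator_mapping_def lookup_Abs_poly_mapping)

lemma keys_indicator_mapping:
  assumes "finite A"
  shows "Poly_Mapping.keys (indicator_mapping A :: 'x \<Rightarrow>\<^sub>0 'b::zero_neq_one) = A"
  using assms by (auto simp: in_keys_iff lookup_indicator_mapping)

text \<open>The inner mapping, with values in the naturals, is the exponent vector of a squarefree
  monomial; the outer one supplies coefficients.\<close>

definition squarefree_sum :: "'x set set \<Rightarrow> ('x, 'r::zero_neq_one) mpolynomial" where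
  "squarefree_sum F = indicator_mapping (indicator_mapping ` F)"

lemma indeterminates_squarefree_sum:
  assumes "finite F" and "\<And>B. B \<in> F \<Longrightarrow> finite B"
  shows "indeterminates (squarefree_sum F :: ('x, 'r::zero_neq_one) mpolynomial) = \<Union>F"
  using assms by (simp add: squarefree_sum_def indeterminates_def keys_indicator_mapping)

text \<open>The keys of a squarefree monomial give back its set, so no two members of
  \<open>F\<close> merge into one term. Exponents and coefficients equal to one then leave the bare
  products.\<close>

lemma eval_squarefree_sum:
  fixes \<theta> :: "'x \<Rightarrow> 'r::comm_semiring_1"
  assumes "finite F" and finite: "\<And>B. B \<in> F \<Longrightarrow> finite B"
  shows "eval_mpolynomial \<theta> (squarefree_sum F) = (\<Sum>B\<in>F. \<Prod>x\<in>B. \<theta> x)"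
proof -
  have "inj_on (indicator_mapping :: 'x set \<Rightarrow> 'x \<Rightarrow>\<^sub>0 nat) F"
    by (metis finite inj_onI keys_indicator_mapping)
  with assms show ?thesis
    by (simp add: eval_mpolynomial_def squarefree_sum_def keys_indicator_mapping
        lookup_indicator_mapping sum.reindex)
qed

text \<open>Extensionality makes each function recoverable from its graph over \<open>U\<close>;
  otherwise functions differing only outside \<open>U\<close> would share a monomial and be counted
  once.\<close>

lemma eval_squarefree_sum_graphs:
  fixes \<theta> :: "'k \<times> 'a \<Rightarrow> 'r::comm_semiring_1"
  assumes "finite U" and "finite R" and "R \<subseteq> extensional U"
  shows "eval_mpolynomial \<theta> (squarefree_sum ((\<lambda>u. (\<lambda>k. (k, u k)) ` U) ` R))
    = (\<Sum>u\<in>R. \<Prod>k\<in>U. \<theta> (k, u k))"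
proof -
  have "inj_on (\<lambda>u. (\<lambda>k. (k, u k)) ` U) R"
  proof (rule inj_onI)
    fix u w assume "u \<in> R" "w \<in> R" "(\<lambda>k. (k, u k)) ` U = (\<lambda>k. (k, w k)) ` U"
    with assms(3) show "u = w"
      by (intro extensionalityI[of u U w]) auto
  qed
  moreover have "inj_on (\<lambda>k. (k, u k)) U" for u :: "'k \<Rightarrow> 'a"
    by (auto intro: inj_onI)
  ultimately show ?thesis
    using assms by (subst eval_squarefree_sum) (auto simp: sum.reindex prod.reindex)
qed

text \<open>The recursion reads the realization only at disturbance parents, and well-founded
  induction handles the main parents. This allows passing to the restriction of a realization to
  \<open>U\<close>.\<close>

lemma (in latent_dag) potential_outcome_cong:
  assumes "\<And>k. k \<in> U \<Longrightarrow> u k = w k"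
  shows "potential_outcome U E f a u j = potential_outcome U E f a w j"
proof (induction j rule: wf_induct_rule[OF wf_E])
  case (1 j)
  then show ?case
    using assms
    by (subst (1 2) potential_outcome_rec)
      (auto intro!: arg_cong[where f = "f j"] simp: restrict_def fun_eq_iff parents_def
        split: option.split)
qed

lemma satisfying_realizations_PiE:
  "satisfying_realizations U E S f L c a v \<subseteq> (\<Pi>\<^sub>E k\<in>U. S k)"
  by (auto simp: satisfying_realizations_def)

lemma (in latent_dag) finite_satisfying_realizations:
  assumes "\<And>k. k \<in> U \<Longrightarrow> finite (S k)"
  shows "finite (satisfying_realizations U E S f L c a v)"
  using finite_U assms by (intro finite_subset[OF satisfying_realizations_PiE] finite_PiE) auto

context structural_equation_model
begin

lemma disturbance_measurable:
  assumes "k \<in> U"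
  shows "X k \<in> measurable M (count_space (S k))"
  using disturbances_indep assms by (simp add: indep_vars_def)

lemma disturbance_realization_event:
  assumes "u \<in> (\<Pi>\<^sub>E k\<in>U. S k)"
  shows "{\<omega> \<in> space M. \<forall>k\<in>U. X k \<omega> = u k} \<in> events"
proof -
  have "X k -` {u k} \<inter> space M \<in> events" if "k \<in> U" for k
    using that assms by (intro measurable_sets[OF disturbance_measurable]) auto
  moreover have "{\<omega> \<in> space M. X k \<omega> = u k} = X k -` {u k} \<inter> space M" for k
    by auto
  ultimately show ?thesis
    using finite_U by (intro sets.sets_Collect_finite_All) auto
qed

lemma prob_disturbance_realization:
  assumes "u \<in> (\<Pi>\<^sub>E k\<in>U. S k)"
  shows "\<P>(\<omega> in M. \<forall>k\<in>U. X k \<omega> = u k) = (\<Prod>k\<in>U. \<P>(\<omega> in M. X k \<omega> = u k))"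
\<comment> \<open>An empty intersection would be \<open>UNIV\<close> rather than
  \<open>space M\<close>, and \<open>indep_varsD\<close> requires a nonempty index set. With no
  disturbances both sides are one.\<close>
proof (cases "U = {}")
  case True
  then show ?thesis
    by (simp add: prob_space)
next
  case False
  have "prob (\<Inter>k\<in>U. X k -` {u k} \<inter> space M) = (\<Prod>k\<in>U. prob (X k -` {u k} \<inter> space M))"
    using False finite_U assms by (intro indep_varsD[OF disturbances_indep]) auto
  moreover have "(\<Inter>k\<in>U. X k -` {u k} \<inter> space M) = {\<omega> \<in> space M. \<forall>k\<in>U. X k \<omega> = u k}"
    using False by auto
  moreover have "X k -` {u k} \<inter> space M = {\<omega> \<in> space M. X k \<omega> = u k}" for k
    by auto
  ultimately show ?thesis
    by simp
qed

lemma counterfactual_event_eq: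
  "{\<omega> \<in> space M. \<forall>l\<in>L. potential_outcome U E f (a l) (\<lambda>k. X k \<omega>) (c l) = v l}
    = (\<Union>u\<in>satisfying_realizations U E S f L c a v. {\<omega> \<in> space M. \<forall>k\<in>U. X k \<omega> = u k})"
  (is "?A = ?B")
proof (intro equalityI subsetI)
  fix \<omega> assume \<omega>: "\<omega> \<in> ?A"
  \<comment> \<open>\<open>X\<close> also has values at main variables, whereas members of the
    extensional product are \<open>undefined\<close> outside \<open>U\<close>.\<close>
  let ?u = "\<lambda>k\<in>U. X k \<omega>"
  have "?u \<in> (\<Pi>\<^sub>E k\<in>U. S k)"
    using \<omega> measurable_space[OF disturbance_measurable] by auto
  moreover have "potential_outcome U E f (a l) ?u (c l)
      = potential_outcome U E f (a l) (\<lambda>k. X k \<omega>) (c l)" for l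
    by (rule potential_outcome_cong) simp
  ultimately have "?u \<in> satisfying_realizations U E S f L c a v"
    using \<omega> by (simp add: satisfying_realizations_def)
  then show "\<omega> \<in> ?B"
    using \<omega> by (intro UN_I[of ?u]) auto
next
  fix \<omega> assume "\<omega> \<in> ?B"
  then obtain u where u: "u \<in> satisfying_realizations U E S f L c a v"
    and \<omega>: "\<omega> \<in> space M" "\<And>k. k \<in> U \<Longrightarrow> X k \<omega> = u k"
    by auto
  have "potential_outcome U E f (a l) (\<lambda>k. X k \<omega>) (c l)
      = potential_outcome U E f (a l) u (c l)" for l
    using \<omega>(2) by (rule potential_outcome_cong)
  with u \<omega>(1) show "\<omega> \<in> ?A"
    by (simp add: satisfying_realizations_def)
qed

lemma prob_counterfactual:
  "\<P>(\<omega> in M. \<forall>l\<in>L. potential_outcome U E f (a l) (\<lambda>k. X k \<omega>) (c l) = v l)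
    = (\<Sum>u\<in>satisfying_realizations U E S f L c a v. \<Prod>k\<in>U. \<P>(\<omega> in M. X k \<omega> = u k))"
proof -
  let ?R = "satisfying_realizations U E S f L c a v"
  have PiE: "u \<in> (\<Pi>\<^sub>E k\<in>U. S k)" if "u \<in> ?R" for u
    using that satisfying_realizations_PiE by blast
  have "disjoint_family_on (\<lambda>u. {\<omega> \<in> space M. \<forall>k\<in>U. X k \<omega> = u k}) ?R"
    unfolding disjoint_family_on_def
  proof (intro ballI impI)
    fix u w assume "u \<in> ?R" "w \<in> ?R" "u \<noteq> w"
    \<comment> \<open>Both functions are \<open>undefined\<close> outside \<open>U\<close>, so they
      can differ only at a disturbance.\<close>
    then obtain k where "k \<in> U" "u k \<noteq> w k"
      by (meson PiE PiE_ext)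
    then show "{\<omega> \<in> space M. \<forall>k\<in>U. X k \<omega> = u k} \<inter> {\<omega> \<in> space M. \<forall>k\<in>U. X k \<omega> = w k} = {}"
      by auto
  qed
  then have "prob (\<Union>u\<in>?R. {\<omega> \<in> space M. \<forall>k\<in>U. X k \<omega> = u k})
      = (\<Sum>u\<in>?R. \<P>(\<omega> in M. \<forall>k\<in>U. X k \<omega> = u k))"
    using finite_S PiE disturbance_realization_event
    by (intro finite_measure_finite_Union finite_satisfying_realizations) auto
  also have "\<dots> = (\<Sum>u\<in>?R. \<Prod>k\<in>U. \<P>(\<omega> in M. X k \<omega> = u k))"
    using PiE by (intro sum.cong prob_disturbance_realization) auto
  finally show ?thesis
    by (simp only: counterfactual_event_eq)
qed

end

theorem proposition2:
  fixes V U :: "'n set" and E :: "('n \<times> 'n) set"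
    and M :: "'w measure"
    and S :: "'n \<Rightarrow> 'a set"
    and f :: "'n \<Rightarrow> ('n \<Rightarrow> 'a) \<Rightarrow> 'a"
    and X :: "'n \<Rightarrow> 'w \<Rightarrow> 'a"
    and L :: "'l set"
    and c :: "'l \<Rightarrow> 'n" and a :: "'l \<Rightarrow> 'n \<rightharpoonup> 'a" and v :: "'l \<Rightarrow> 'a"
  assumes "canonical_dag V U E"
    and "structural_equation_model V U E M S f X"
    and "\<And>l. l \<in> L \<Longrightarrow> c l \<in> V"
    and "\<And>l. l \<in> L \<Longrightarrow> intervention V S (a l)"
    and "\<And>l. l \<in> L \<Longrightarrow> v l \<in> S (c l)"
  shows "\<P>(\<omega> in M. \<forall>l\<in>L. potential_outcome U E f (a l) (\<lambda>k. X k \<omega>) (c l) = v l)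
           = (\<Sum>u\<in>satisfying_realizations U E S f L c a v. \<Prod>k\<in>U. \<P>(\<omega> in M. X k \<omega> = u k))
       \<and> (\<exists>Q :: ('n \<times> 'a, real) mpolynomial.
             indeterminates Q \<subseteq> (SIGMA k:U. S k)
           \<and> (\<forall>\<theta>. eval_mpolynomial \<theta> Q =
               (\<Sum>u\<in>satisfying_realizations U E S f L c a v. \<Prod>k\<in>U. \<theta> (k, u k)))
           \<and> \<P>(\<omega> in M. \<forall>l\<in>L. potential_outcome U E f (a l) (\<lambda>k. X k \<omega>) (c l) = v l)
               = eval_mpolynomial (\<lambda>(k, x). \<P>(\<omega> in M. X k \<omega> = x)) Q)"
proof -
  interpret structural_equation_model V U E M S f X
    by fact
  let ?R = "satisfying_realizations U E S f L c a v"
  \<comment> \<open>The indeterminate \<open>(k, x)\<close> stands for the probability that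
    disturbance \<open>k\<close> takes the value \<open>x\<close>, so the graph of \<open>u\<close>
    lists the factors of its term.\<close>
  let ?F = "(\<lambda>u. (\<lambda>k. (k, u k)) ` U) ` ?R"
  let ?Q = "squarefree_sum ?F :: ('n \<times> 'a, real) mpolynomial"
  have R: "finite ?R" "?R \<subseteq> (\<Pi>\<^sub>E k\<in>U. S k)"
    using finite_S by (auto intro!: finite_satisfying_realizations satisfying_realizations_PiE)
  have "indeterminates ?Q = \<Union>?F"
    using R finite_U by (intro indeterminates_squarefree_sum) auto
  then have "indeterminates ?Q \<subseteq> (SIGMA k:U. S k)"
    using R by auto
  \<comment> \<open>Valid for every \<theta>, so \<open>?Q\<close> does not depend on the
    disturbance distribution; inserting the actual probabilities and using
    \<open>prob_counterfactual\<close> yields the last conjunct.\<close>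
  moreover have eval: "eval_mpolynomial \<theta> ?Q = (\<Sum>u\<in>?R. \<Prod>k\<in>U. \<theta> (k, u k))" for \<theta>
    using R finite_U by (intro eval_squarefree_sum_graphs) (auto simp: PiE_def)
  ultimately show ?thesis
    by (intro conjI exI[of _ ?Q] allI) (simp_all add: prob_counterfactual)
qed

end
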